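(* Let $G$ be a finite group, $n\ge 0$ an integer, and $X$ a $G$-space with $\operatorname{ind} X < \infty$. Then \[ \operatorname{ind} (X\times E_nG)=\min\{\operatorname{ind} X,\, n\}. \]
   Context: $E_kG=G*G*\cdots*G$ ($k+1$ factors), where $G$ is a discrete space with left multiplication action and the join $A*B$ (points written $(1-t)a\oplus tb$) carries the action $g\cdot((1-t)a\oplus tb)=(1-t)(ga)\oplus t(gb)$. The mapping index $\operatorname{ind} X$ of a $G$-space $X$ is the minimal $k$ such that there exists a $G$-equivariant map $X\to E_kG$. Products carry the diagonal action. *)

theory Defs
  imports "HOL-Analysis.Analysis" "HOL-Algebra.Group_Action" "HOL-Library.Extended_Nat"
begin

locale G_space = group_action G "topspace X" \<phi>
  for G :: "('g, 'm) monoid_scheme" (structure)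
    and X :: "'x topology" and \<phi> :: "'g \<Rightarrow> 'x \<Rightarrow> 'x" +
  assumes continuous_action:
    "continuous_map (prod_topology (discrete_topology (carrier G)) X) X (\<lambda>(g, x). \<phi> g x)"

definition equivariant_map ::
  "('g, 'm) monoid_scheme \<Rightarrow> 'x topology \<Rightarrow> ('g \<Rightarrow> 'x \<Rightarrow> 'x) \<Rightarrow>
   'y topology \<Rightarrow> ('g \<Rightarrow> 'y \<Rightarrow> 'y) \<Rightarrow> ('x \<Rightarrow> 'y) \<Rightarrow> bool"
  where "equivariant_map G X \<phi> Y \<psi> f \<longleftrightarrow>
    continuous_map X Y f \<and>
    (\<forall>g \<in> carrier G. \<forall>x \<in> topspace X. f (\<phi> g x) = \<psi> g (f x))"

text \<open>Actions in the sense of \<^locale>\<open>group_action\<close> are by extensional functions,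
  which is why the concrete actions below are restricted to the underlying set.\<close>

definition diagonal_action ::
  "'x topology \<Rightarrow> ('g \<Rightarrow> 'x \<Rightarrow> 'x) \<Rightarrow> 'y topology \<Rightarrow> ('g \<Rightarrow> 'y \<Rightarrow> 'y) \<Rightarrow>
   'g \<Rightarrow> 'x \<times> 'y \<Rightarrow> 'x \<times> 'y"
  where "diagonal_action X \<phi> Y \<psi> g =
    (\<lambda>(x, y) \<in> topspace (prod_topology X Y). (\<phi> g x, \<psi> g y))"

definition quotient_topology :: "'a topology \<Rightarrow> ('a \<Rightarrow> 'b) \<Rightarrow> 'b topology"
  where "quotient_topology X q =
    topology (\<lambda>U. U \<subseteq> q ` topspace X \<and> openin X {x \<in> topspace X. q x \<in> U})"

text \<open>Points of iterated joins of \<open>G\<close> with itself, all in one type so that the number of factors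
  can be a variable. \<open>Leaf h\<close> is a point of \<open>G\<close>; the points \<open>(1 - t) a \<oplus> t b\<close> of a join are
  \<open>LeftEnd a\<close> for \<open>t = 0\<close> (independent of \<open>b\<close>), \<open>RightEnd b\<close> for \<open>t = 1\<close> (independent of \<open>a\<close>)
  and \<open>Mix t a b\<close> for \<open>0 < t < 1\<close>.\<close>

datatype 'g join_point =
    Leaf 'g
  | LeftEnd "'g join_point"
  | RightEnd "'g join_point"
  | Mix real "'g join_point" "'g join_point"

definition join_comb :: "real \<Rightarrow> 'g join_point \<Rightarrow> 'g join_point \<Rightarrow> 'g join_point"
  where "join_comb t a b =
    (if t = 0 then LeftEnd a else if t = 1 then RightEnd b else Mix t a b)"

definition join_topology ::
  "'g join_point topology \<Rightarrow> 'g join_point topology \<Rightarrow> 'g join_point topology"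
  where "join_topology A B =
    quotient_topology
      (prod_topology (top_of_set {0..1::real}) (prod_topology A B))
      (\<lambda>(t, a, b). join_comb t a b)"

fun E_space :: "('g, 'm) monoid_scheme \<Rightarrow> nat \<Rightarrow> 'g join_point topology"
  where
    "E_space G 0 = discrete_topology (Leaf ` carrier G)"
  | "E_space G (Suc k) = join_topology (E_space G k) (E_space G 0)"

primrec translate :: "('g, 'm) monoid_scheme \<Rightarrow> 'g \<Rightarrow> 'g join_point \<Rightarrow> 'g join_point"
  where
    "translate G g (Leaf h) = Leaf (g \<otimes>\<^bsub>G\<^esub> h)"
  | "translate G g (LeftEnd a) = LeftEnd (translate G g a)"
  | "translate G g (RightEnd b) = RightEnd (translate G g b)"
  | "translate G g (Mix t a b) = Mix t (translate G g a) (translate G g b)"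

definition E_action ::
  "('g, 'm) monoid_scheme \<Rightarrow> nat \<Rightarrow> 'g \<Rightarrow> 'g join_point \<Rightarrow> 'g join_point"
  where "E_action G k g = restrict (translate G g) (topspace (E_space G k))"

text \<open>The infimum of the empty set of extended naturals is \<open>\<infinity>\<close>.\<close>

definition mapping_index ::
  "('g, 'm) monoid_scheme \<Rightarrow> 'x topology \<Rightarrow> ('g \<Rightarrow> 'x \<Rightarrow> 'x) \<Rightarrow> enat"
  where "mapping_index G X \<phi> =
    Inf {enat k | k. \<exists>f. equivariant_map G X \<phi> (E_space G k) (E_action G k) f}"

lemma openin_quotient_topology:
  "openin (quotient_topology X q) U \<longleftrightarrow>
     U \<subseteq> q ` topspace X \<and> openin X {x \<in> topspace X. q x \<in> U}"
proof -
  have "istopology (\<lambda>U. U \<subseteq> q ` topspace X \<and> openin X {x \<in> topspace X. q x \<in> U})"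
    unfolding istopology_def
  proof (intro conjI allI impI; (elim conjE)?)
    fix S T
    assume S: "openin X {x \<in> topspace X. q x \<in> S}" and T: "openin X {x \<in> topspace X. q x \<in> T}"
    have "{x \<in> topspace X. q x \<in> S \<inter> T} =
        {x \<in> topspace X. q x \<in> S} \<inter> {x \<in> topspace X. q x \<in> T}"
      by auto
    then show "openin X {x \<in> topspace X. q x \<in> S \<inter> T}"
      using S T by (simp add: openin_Int)
  next
    fix K
    assume K: "\<forall>U\<in>K. U \<subseteq> q ` topspace X \<and> openin X {x \<in> topspace X. q x \<in> U}"
    then show "\<Union>K \<subseteq> q ` topspace X"
      by blast
    have "{x \<in> topspace X. q x \<in> \<Union>K} = (\<Union>U\<in>K. {x \<in> topspace X. q x \<in> U})"
      by auto
    then show "openin X {x \<in> topspace X. q x \<in> \<Union>K}"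
      using K by auto
  qed auto
  then show ?thesis
    by (simp add: quotient_topology_def topology_inverse')
qed

lemma topspace_quotient_topology [simp]: "topspace (quotient_topology X q) = q ` topspace X"
proof
  have "{x \<in> topspace X. q x \<in> q ` topspace X} = topspace X"
    by auto
  then have "openin (quotient_topology X q) (q ` topspace X)"
    by (simp add: openin_quotient_topology)
  then show "q ` topspace X \<subseteq> topspace (quotient_topology X q)"
    by (rule openin_subset)
  show "topspace (quotient_topology X q) \<subseteq> q ` topspace X"
    using openin_topspace[of "quotient_topology X q"] unfolding openin_quotient_topology by blast
qed

lemma quotient_map_quotient_topology: "quotient_map X (quotient_topology X q) q"
  by (auto simp: quotient_map_def openin_quotient_topology)

lemma translate_join_comb:
  "translate G g (join_comb t a b) = join_comb t (translate G g a) (translate G g b)"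
  by (simp add: join_comb_def)

lemma (in G_space) continuous_map_act:
  assumes "g \<in> carrier G"
  shows "continuous_map X X (\<phi> g)"
proof -
  have "continuous_map X (prod_topology (discrete_topology (carrier G)) X) (\<lambda>x. (g, x))"
    using assms by (simp add: continuous_map_pairwise o_def)
  then show ?thesis
    using continuous_map_compose[OF _ continuous_action, of X "\<lambda>x. (g, x)"] by (simp add: o_def)
qed

lemma G_spaceI:
  fixes G :: "('g, 'm) monoid_scheme" (structure)
  assumes G: "group G"
    and cont: "\<And>g. g \<in> carrier G \<Longrightarrow> continuous_map X X (act g)"
    and one: "\<And>x. x \<in> topspace X \<Longrightarrow> act \<one> x = x"
    and mult: "\<And>g h x. \<lbrakk>g \<in> carrier G; h \<in> carrier G; x \<in> topspace X\<rbrakk>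
      \<Longrightarrow> act (g \<otimes> h) x = act g (act h x)"
  shows "G_space G X (\<lambda>g. restrict (act g) (topspace X))"
proof -
  interpret group G by (fact G)
  let ?\<phi> = "\<lambda>g. restrict (act g) (topspace X)"
  have clos: "act g x \<in> topspace X" if "g \<in> carrier G" "x \<in> topspace X" for g x
    using continuous_map_image_subset_topspace[OF cont[OF that(1)]] that(2) by auto
  have bij: "?\<phi> g \<in> Bij (topspace X)" if g: "g \<in> carrier G" for g
  proof -
    have "bij_betw (act g) (topspace X) (topspace X)"
    proof (rule bij_betw_byWitness[where f' = "act (inv g)"])
      show "\<forall>x\<in>topspace X. act (inv g) (act g x) = x"
        using g one by (metis inv_closed l_inv mult)
      show "\<forall>x\<in>topspace X. act g (act (inv g) x) = x"
        using g one by (metis inv_closed r_inv mult)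
    qed (use g clos in auto)
    then show ?thesis
      by (simp add: Bij_def)
  qed
  have "?\<phi> \<in> hom G (BijGroup (topspace X))"
    using bij by (auto simp: hom_def BijGroup_def compose_def fun_eq_iff mult clos)
  then have act: "group_action G (topspace X) ?\<phi>"
    using group_BijGroup by (auto simp: group_action_def group_hom_def group_hom_axioms_def G)
  have "openin (prod_topology (discrete_topology (carrier G)) X)
      {p \<in> carrier G \<times> topspace X. (\<lambda>(g, x). ?\<phi> g x) p \<in> U}" if U: "openin X U" for U
  proof -
    have "{p \<in> carrier G \<times> topspace X. (\<lambda>(g, x). ?\<phi> g x) p \<in> U} =
        (\<Union>g\<in>carrier G. {g} \<times> {x \<in> topspace X. act g x \<in> U})"
      by auto
    moreover have "openin X {x \<in> topspace X. act g x \<in> U}" if "g \<in> carrier G" for g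
      using cont[OF that] U by (simp add: continuous_map_def)
    ultimately show ?thesis
      by (auto intro!: openin_Union simp: openin_prod_Times_iff)
  qed
  then have "continuous_map (prod_topology (discrete_topology (carrier G)) X) X (\<lambda>(g, x). ?\<phi> g x)"
    by (auto simp: continuous_map_def clos)
  with act show ?thesis
    by (simp add: G_space_def G_space_axioms_def)
qed

lemma G_space_prod:
  fixes G :: "('g, 'm) monoid_scheme" (structure)
  assumes X: "G_space G X \<phi>" and Y: "G_space G Y \<psi>"
  shows "G_space G (prod_topology X Y) (diagonal_action X \<phi> Y \<psi>)"
proof -
  interpret X: G_space G X \<phi> by (fact X)
  interpret Y: G_space G Y \<psi> by (fact Y)
  have G: "group G"
    using X.group_hom by (simp add: group_hom_def)
  have "G_space G (prod_topology X Y)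
      (\<lambda>g. restrict (\<lambda>(x, y). (\<phi> g x, \<psi> g y)) (topspace (prod_topology X Y)))"
  proof (rule G_spaceI[OF G])
    fix g assume g: "g \<in> carrier G"
    show "continuous_map (prod_topology X Y) (prod_topology X Y) (\<lambda>(x, y). (\<phi> g x, \<psi> g y))"
      using continuous_map_compose[OF continuous_map_fst X.continuous_map_act[OF g], of Y]
        continuous_map_compose[OF continuous_map_snd Y.continuous_map_act[OF g], of X]
      by (simp add: continuous_map_pairwise o_def case_prod_unfold)
  next
    fix p assume "p \<in> topspace (prod_topology X Y)"
    then show "(case p of (x, y) \<Rightarrow> (\<phi> \<one> x, \<psi> \<one> y)) = p"
      using X.id_eq_one Y.id_eq_one by (auto simp: fun_eq_iff) (metis restrict_apply')+
  next
    fix g h p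
    assume "g \<in> carrier G" "h \<in> carrier G" "p \<in> topspace (prod_topology X Y)"
    then show "(case p of (x, y) \<Rightarrow> (\<phi> (g \<otimes> h) x, \<psi> (g \<otimes> h) y)) =
        (case case p of (x, y) \<Rightarrow> (\<phi> h x, \<psi> h y) of (x, y) \<Rightarrow> (\<phi> g x, \<psi> g y))"
      using X.composition_rule Y.composition_rule by auto
  qed
  then show ?thesis
    by (simp add: diagonal_action_def[abs_def])
qed

lemma continuous_map_translate_E_space:
  fixes G :: "('g, 'm) monoid_scheme" (structure)
  assumes "group G" "g \<in> carrier G"
  shows "continuous_map (E_space G k) (E_space G k) (translate G g)"
proof (induction k)
  case 0
  interpret group G by (fact assms(1))
  show ?case
    using assms(2) by (auto simp: continuous_map_def)
next
  case (Suc k)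
  interpret group G by (fact assms(1))
  have zero: "continuous_map (E_space G 0) (E_space G 0) (translate G g)"
    using assms(2) by (auto simp: continuous_map_def)
  let ?Z = "prod_topology (top_of_set {0..1::real}) (prod_topology (E_space G k) (E_space G 0))"
  let ?q = "\<lambda>(t, a, b). join_comb t a b"
  let ?T = "\<lambda>(t, a, b). (t :: real, translate G g a, translate G g b)"
  have q: "quotient_map ?Z (E_space G (Suc k)) ?q"
    by (simp only: E_space.simps(2) join_topology_def quotient_map_quotient_topology)
  have "continuous_map ?Z (E_space G k) (translate G g \<circ> (fst \<circ> snd))"
    by (intro continuous_map_compose[OF _ Suc.IH] continuous_map_compose[OF continuous_map_snd]
        continuous_map_fst)
  moreover have "continuous_map ?Z (E_space G 0) (translate G g \<circ> (snd \<circ> snd))"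
    by (intro continuous_map_compose[OF _ zero] continuous_map_compose[OF continuous_map_snd]
        continuous_map_snd)
  ultimately have T: "continuous_map ?Z ?Z ?T"
    by (simp add: continuous_map_pairwise continuous_map_fst o_def case_prod_unfold
        del: E_space.simps)
  have "translate G g \<circ> ?q = ?q \<circ> ?T"
    by (auto simp: fun_eq_iff translate_join_comb)
  moreover have "continuous_map ?Z (E_space G (Suc k)) (?q \<circ> ?T)"
    by (rule continuous_map_compose[OF T quotient_imp_continuous_map[OF q]])
  ultimately show ?case
    using continuous_compose_quotient_map[OF q] by metis
qed

lemma G_space_E_space:
  fixes G :: "('g, 'm) monoid_scheme" (structure)
  assumes G: "group G"
  shows "G_space G (E_space G k) (E_action G k)"
proof -
  interpret group G by (fact G)
  have "translate G \<one> x = x" if "x \<in> topspace (E_space G k)" for x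
    using that
    by (induction k arbitrary: x) (auto simp: join_topology_def translate_join_comb)
  moreover have "translate G (g \<otimes> h) x = translate G g (translate G h x)"
    if "g \<in> carrier G" "h \<in> carrier G" "x \<in> topspace (E_space G k)" for g h x
    using that
    by (induction k arbitrary: x) (auto simp: join_topology_def translate_join_comb m_assoc)
  ultimately show ?thesis
    unfolding E_action_def[abs_def]
    by (intro G_spaceI[OF G] continuous_map_translate_E_space[OF G])
qed

end

theory Submission
  imports Defs
begin

text \<open>Only the inequality \<open>\<ge>\<close> is not formal. Let \<open>k < n\<close> and let \<open>f : X \<times> E\<^sub>n \<rightarrow> E\<^sub>k\<close> be equivariant; we
  find an equivariant map \<open>X \<rightarrow> E\<^sub>k\<close> by induction on an \<open>m\<close> for which there is an equivariant map
  \<open>X \<rightarrow> E\<^sub>m\<close>. If \<open>m \<le> n\<close>, then \<open>X\<close> maps to \<open>E\<^sub>n\<close>, hence to \<open>X \<times> E\<^sub>n\<close>, hence to \<open>E\<^sub>k\<close>.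
  For \<open>X \<rightarrow> E\<^sub>m * G\<close> with join parameter \<open>t\<close>, the open part \<open>t < 1\<close> maps to \<open>E\<^sub>m\<close>, so by induction
  to \<open>E\<^sub>k\<close>, and the open part \<open>t > 0\<close> maps to \<open>G\<close>. Joining the two maps gives
  \<open>X \<rightarrow> E\<^sub>k * G = E\<^sub>k\<^sub>+\<^sub>1\<close>, and since \<open>k + 1 \<le> n\<close> the first case applies.\<close>

section \<open>Equivariant maps\<close>

lemma equivariant_map_compose:
  assumes "equivariant_map G X \<phi> Y \<psi> f" "equivariant_map G Y \<psi> Z \<theta> h"
  shows "equivariant_map G X \<phi> Z \<theta> (h \<circ> f)"
  using assms continuous_map_image_subset_topspace[of X Y f]
  by (auto simp: equivariant_map_def intro: continuous_map_compose)

lemma equivariant_map_fst: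
  "equivariant_map G (prod_topology X Y) (diagonal_action X \<phi> Y \<psi>) X \<phi> fst"
  by (auto simp: equivariant_map_def diagonal_action_def continuous_map_fst)

lemma equivariant_map_snd:
  "equivariant_map G (prod_topology X Y) (diagonal_action X \<phi> Y \<psi>) Y \<psi> snd"
  by (auto simp: equivariant_map_def diagonal_action_def continuous_map_snd)

lemma equivariant_map_graph:
  assumes "equivariant_map G X \<phi> Y \<psi> f"
  shows "equivariant_map G X \<phi> (prod_topology X Y) (diagonal_action X \<phi> Y \<psi>) (\<lambda>x. (x, f x))"
  using assms continuous_map_image_subset_topspace[of X Y f]
  by (auto simp: equivariant_map_def diagonal_action_def continuous_map_pairwise o_def)

text \<open>Serves the induction over \<open>m\<close>, where \<open>X\<close> shrinks to an open
  part while the map out of the product stays the same function.\<close>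

lemma equivariant_map_prod_from_subtopology:
  assumes "equivariant_map G (prod_topology X Y) (diagonal_action X \<phi> Y \<psi>) Z \<theta> f"
  shows "equivariant_map G (prod_topology (subtopology X S) Y)
    (diagonal_action (subtopology X S) \<phi> Y \<psi>) Z \<theta> f"
proof -
  have "prod_topology (subtopology X S) Y = subtopology (prod_topology X Y) (S \<times> UNIV)"
    by (simp add: subtopology_Times[of X Y S UNIV, simplified])
  with assms show ?thesis
    by (auto simp: equivariant_map_def diagonal_action_def continuous_map_from_subtopology)
qed

text \<open>\<open>E_action\<close> is \<open>translate\<close> cut down to the space, and the
  values of \<open>f\<close> lie there, so one can compute with \<open>translate\<close>, which
  commutes with the join constructors.\<close>

lemma equivariant_map_E_space_iff:
  "equivariant_map G X \<phi> (E_space G k) (E_action G k) f \<longleftrightarrow>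
    continuous_map X (E_space G k) f \<and>
    (\<forall>g \<in> carrier G. \<forall>x \<in> topspace X. f (\<phi> g x) = translate G g (f x))"
  using continuous_map_image_subset_topspace[of X "E_space G k" f]
  by (auto simp: equivariant_map_def E_action_def)

lemma equivariant_map_E_space_Suc_iff:
  "equivariant_map G X \<phi> (E_space G (Suc k)) (E_action G (Suc k)) f \<longleftrightarrow>
    continuous_map X (join_topology (E_space G k) (E_space G 0)) f \<and>
    (\<forall>g \<in> carrier G. \<forall>x \<in> topspace X. f (\<phi> g x) = translate G g (f x))"
  unfolding equivariant_map_E_space_iff by (simp only: E_space.simps(2))

section \<open>Joins\<close>

lemma quotient_map_join_comb:
  "quotient_map (prod_topology (top_of_set {0..1::real}) (prod_topology A B)) (join_topology A B)
    (\<lambda>(t, a, b). join_comb t a b)"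
  by (simp add: join_topology_def quotient_map_quotient_topology)

lemma topspace_join_topology:
  "topspace (join_topology A B) =
    {join_comb t a b |t a b. t \<in> {0..1} \<and> a \<in> topspace A \<and> b \<in> topspace B}"
  by (force simp: join_topology_def)

lemma continuous_map_join_comb:
  assumes "continuous_map X (top_of_set {0..1}) u" "continuous_map X A p" "continuous_map X B r"
  shows "continuous_map X (join_topology A B) (\<lambda>x. join_comb (u x) (p x) (r x))"
proof -
  have "continuous_map X (prod_topology (top_of_set {0..1}) (prod_topology A B))
      (\<lambda>x. (u x, p x, r x))"
    using assms by (simp add: continuous_map_pairwise o_def)
  from continuous_map_compose[OF this quotient_imp_continuous_map[OF quotient_map_join_comb]]
  show ?thesis
    by (simp add: o_def)
qed

text \<open>At \<open>t = 0\<close> the right coordinate is forgotten, so any constant point of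
  \<open>B\<close> completes \<open>p x\<close> to a triple. \<open>RightEnd\<close> is
  symmetric.\<close>

lemma continuous_map_LeftEnd:
  assumes "continuous_map X A p" "topspace B \<noteq> {}"
  shows "continuous_map X (join_topology A B) (\<lambda>x. LeftEnd (p x))"
proof -
  obtain b where "b \<in> topspace B"
    using assms(2) by blast
  then show ?thesis
    using continuous_map_join_comb[of X "\<lambda>_. 0" A p B "\<lambda>_. b"] assms(1)
    by (simp add: join_comb_def)
qed

lemma continuous_map_RightEnd:
  assumes "continuous_map X B r" "topspace A \<noteq> {}"
  shows "continuous_map X (join_topology A B) (\<lambda>x. RightEnd (r x))"
proof -
  obtain a where "a \<in> topspace A"
    using assms(2) by blast
  then show ?thesis
    using continuous_map_join_comb[of X "\<lambda>_. 1" A "\<lambda>_. a" B r] assms(1)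
    by (simp add: join_comb_def)
qed

text \<open>The coordinates \<open>t\<close>, \<open>a\<close>, \<open>b\<close> of \<open>(1 - t) a \<oplus> t b\<close>; the second is meaningful only for
  \<open>t < 1\<close> and the third only for \<open>t > 0\<close>.\<close>

fun join_param :: "'g join_point \<Rightarrow> real"
  where
    "join_param (RightEnd b) = 1"
  | "join_param (Mix t a b) = t"
  | "join_param _ = 0"

fun join_left :: "'g join_point \<Rightarrow> 'g join_point"
  where
    "join_left (LeftEnd a) = a"
  | "join_left (Mix t a b) = a"
  | "join_left x = x"

fun join_right :: "'g join_point \<Rightarrow> 'g join_point"
  where
    "join_right (RightEnd b) = b"
  | "join_right (Mix t a b) = b"
  | "join_right x = x"

lemma join_param_join_comb [simp]: "join_param (join_comb t a b) = t"
  by (simp add: join_comb_def)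

lemma join_left_join_comb [simp]: "t \<noteq> 1 \<Longrightarrow> join_left (join_comb t a b) = a"
  by (simp add: join_comb_def)

lemma join_right_join_comb [simp]: "t \<noteq> 0 \<Longrightarrow> join_right (join_comb t a b) = b"
  by (simp add: join_comb_def)

lemma join_param_translate [simp]: "join_param (translate G g x) = join_param x"
  by (cases x) simp_all

lemma continuous_map_join_param:
  "continuous_map (join_topology A B) (top_of_set {0..1}) join_param"
proof (rule continuous_compose_quotient_map[OF quotient_map_join_comb])
  show "continuous_map (prod_topology (top_of_set {0..1}) (prod_topology A B)) (top_of_set {0..1})
      (join_param \<circ> (\<lambda>(t, a, b). join_comb t a b))"
    by (rule continuous_map_eq[OF continuous_map_fst]) auto
qed

lemma openin_join_param_vimage:
  assumes "open T"
  shows "openin (join_topology A B) {x \<in> topspace (join_topology A B). join_param x \<in> T}"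
proof -
  have "continuous_map (join_topology A B) euclideanreal join_param"
    using continuous_map_join_param continuous_map_into_fulltopology by blast
  then show ?thesis
    using assms by (simp add: continuous_map_def)
qed

text \<open>Over an open set a quotient map restricts to a quotient map, so continuity can be tested
  on triples with \<open>t \<in> T\<close>. This handles coordinates that are well defined only on
  an open part of the join.\<close>

lemma continuous_map_on_join_param:
  assumes T: "open T"
    and h: "continuous_map (prod_topology (top_of_set {0..1}) (prod_topology A B)) C h"
    and f: "\<And>t a b. t \<in> T \<Longrightarrow> f (join_comb t a b) = h (t, a, b)"
  shows "continuous_map (subtopology (join_topology A B) {x. join_param x \<in> T}) C f"
proof -
  let ?Z = "prod_topology (top_of_set {0..1::real}) (prod_topology A B)"
  let ?q = "\<lambda>(t, a, b). join_comb t a b"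
  let ?U = "{x \<in> topspace (join_topology A B). join_param x \<in> T}"
  have "quotient_map (subtopology ?Z {z \<in> topspace ?Z. ?q z \<in> ?U})
      (subtopology (join_topology A B) ?U) ?q"
    by (rule quotient_map_restriction[OF quotient_map_join_comb])
      (simp_all add: openin_join_param_vimage[OF T])
  moreover have "continuous_map (subtopology ?Z {z \<in> topspace ?Z. ?q z \<in> ?U}) C (f \<circ> ?q)"
    by (rule continuous_map_eq[OF continuous_map_from_subtopology[OF h]]) (auto simp: f)
  ultimately have "continuous_map (subtopology (join_topology A B) ?U) C f"
    by (rule continuous_compose_quotient_map)
  moreover have "?U = topspace (join_topology A B) \<inter> {x. join_param x \<in> T}"
    by blast
  ultimately show ?thesis
    by (simp only: subtopology_restrict)
qed

lemma continuous_map_join_left: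
  "continuous_map (subtopology (join_topology A B) {x. join_param x < 1}) A join_left"
  using continuous_map_on_join_param[of "{..<1}" A B A "fst \<circ> snd" join_left]
  by (simp add: continuous_map_compose[OF continuous_map_snd continuous_map_fst])

lemma continuous_map_join_right:
  "continuous_map (subtopology (join_topology A B) {x. 0 < join_param x}) B join_right"
  using continuous_map_on_join_param[of "{0<..}" A B B "snd \<circ> snd" join_right]
  by (simp add: continuous_map_compose[OF continuous_map_snd continuous_map_snd])

lemma join_left_translate:
  assumes "x \<in> topspace (join_topology A B)" "join_param x < 1"
  shows "join_left (translate G g x) = translate G g (join_left x)"
  using assms by (auto simp: topspace_join_topology translate_join_comb)

lemma join_right_translate:
  assumes "x \<in> topspace (join_topology A B)" "0 < join_param x"
  shows "join_right (translate G g x) = translate G g (join_right x)"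
  using assms by (auto simp: topspace_join_topology translate_join_comb)

section \<open>Maps into the spaces E\<close>

lemma topspace_E_space_nonempty:
  assumes "group G"
  shows "topspace (E_space G k) \<noteq> {}"
proof (induction k)
  case 0
  interpret group G by (fact assms)
  show ?case
    by auto
next
  case (Suc k)
  interpret group G by (fact assms)
  show ?case
    using Suc by (auto simp: join_topology_def)
qed

text \<open>Each space embeds equivariantly into the next as the end \<open>t = 0\<close> of the
  join.\<close>

lemma equivariant_map_E_space_mono:
  assumes G: "group G" and "k \<le> n"
    and "\<exists>f. equivariant_map G X \<phi> (E_space G k) (E_action G k) f"
  shows "\<exists>f. equivariant_map G X \<phi> (E_space G n) (E_action G n) f"
  using assms(2,3)
proof (induction n rule: dec_induct)
  case (step n)
  then obtain f where f: "equivariant_map G X \<phi> (E_space G n) (E_action G n) f"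
    by blast
  then have "equivariant_map G X \<phi> (E_space G (Suc n)) (E_action G (Suc n)) (\<lambda>x. LeftEnd (f x))"
    using continuous_map_LeftEnd[of X "E_space G n" f "E_space G 0"]
      topspace_E_space_nonempty[OF G, of 0]
    unfolding equivariant_map_E_space_Suc_iff by (simp add: equivariant_map_E_space_iff)
  then show ?case
    by blast
qed

text \<open>Exchanges the factor \<open>E_space G m\<close> of the target for
  \<open>E_space G k\<close>, although \<open>p\<close> is controlled only where the left coordinate
  of \<open>f\<close> exists.\<close>

lemma equivariant_map_E_space_Suc_extend:
  assumes G: "group G"
    and f: "equivariant_map G X \<phi> (E_space G (Suc m)) (E_action G (Suc m)) f"
    and p: "equivariant_map G (subtopology X {x. join_param (f x) < 1}) \<phi>
      (E_space G k) (E_action G k) p"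
  shows "\<exists>h. equivariant_map G X \<phi> (E_space G (Suc k)) (E_action G (Suc k)) h"
proof -
  let ?J = "join_topology (E_space G m) (E_space G 0)"
  let ?K = "join_topology (E_space G k) (E_space G 0)"
  define t where "t = join_param \<circ> f"
  define r where "r = join_right \<circ> f"
  \<comment> \<open>Reparametrising by \<open>u\<close> makes the joined map locally independent of the coordinate that
    becomes undefined near \<open>t = 0\<close> or \<open>t = 1\<close>.\<close>
  define u :: "real \<Rightarrow> real" where "u = (\<lambda>s. max 0 (min 1 (3 * s - 1)))"
  define h where "h = (\<lambda>x. join_comb (u (t x)) (p x) (r x))"
  have f_cont: "continuous_map X ?J f"
    and f_eq: "\<And>g x. g \<in> carrier G \<Longrightarrow> x \<in> topspace X \<Longrightarrow> f (\<phi> g x) = translate G g (f x)"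
    using f by (simp_all only: equivariant_map_E_space_Suc_iff)
  have p_cont: "continuous_map (subtopology X {x. t x < 1}) (E_space G k) p"
    and p_eq: "\<And>g x. g \<in> carrier G \<Longrightarrow> x \<in> topspace X \<Longrightarrow> t x < 1 \<Longrightarrow> p (\<phi> g x) = translate G g (p x)"
    using p by (auto simp: equivariant_map_E_space_iff t_def)
  have f_in: "f x \<in> topspace ?J" if "x \<in> topspace X" for x
    using continuous_map_image_subset_topspace[OF f_cont] that by blast
  have t_in: "t x \<in> {0..1}" if "x \<in> topspace X" for x
    using f_in[OF that] by (auto simp: topspace_join_topology t_def)
  have t_cont: "continuous_map X euclideanreal t"
    unfolding t_def using continuous_map_compose[OF f_cont continuous_map_join_param]
      continuous_map_into_fulltopology by blast
  have r_cont: "continuous_map (subtopology X {x. 0 < t x}) (E_space G 0) r"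
    unfolding r_def
  proof (rule continuous_map_compose[OF _ continuous_map_join_right])
    show "continuous_map (subtopology X {x. 0 < t x}) (subtopology ?J {x. 0 < join_param x}) f"
      using f_cont by (auto simp: continuous_map_in_subtopology continuous_map_from_subtopology t_def)
  qed
  have u_cont: "continuous_map X (top_of_set {0..1}) (\<lambda>x. u (t x))"
  proof -
    have "continuous_map euclideanreal euclideanreal u"
      unfolding u_def by (auto intro!: continuous_intros)
    then have "continuous_map X euclideanreal (u \<circ> t)"
      using t_cont continuous_map_compose by blast
    then show ?thesis
      by (auto simp: continuous_map_in_subtopology u_def o_def)
  qed
  \<comment> \<open>Three open sets covering the line. On the first \<open>u = 0\<close>, so
    \<open>h\<close> is \<open>LeftEnd\<close> of \<open>p\<close>; on the last
    \<open>u = 1\<close>, so \<open>h\<close> is \<open>RightEnd\<close> of \<open>r\<close>; on the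
    middle one both \<open>p\<close> and \<open>r\<close> are continuous.\<close>
  define T :: "nat \<Rightarrow> real set" where
    "T = (\<lambda>i. if i = 0 then {..<1/3} else if i = 1 then {0<..<1} else {2/3<..})"
  have "continuous_map X ?K h"
  proof (rule pasting_lemma[where I = "{0, 1, 2}" and T = "\<lambda>i. {x \<in> topspace X. t x \<in> T i}"
        and f = "\<lambda>_. h"])
    fix i :: nat
    have "open (T i)"
      by (simp add: T_def)
    then show "openin X {x \<in> topspace X. t x \<in> T i}"
      using t_cont by (simp add: continuous_map_def)
    assume "i \<in> {0, 1, 2}"
    then consider "i = 0" | "i = 1" | "i = 2"
      by blast
    then show "continuous_map (subtopology X {x \<in> topspace X. t x \<in> T i}) ?K h"
    proof cases
      case 1
      have "continuous_map (subtopology X {x \<in> topspace X. t x \<in> T i}) (E_space G k) p"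
        using p_cont by (rule continuous_map_from_subtopology_mono) (auto simp: 1 T_def)
      then have "continuous_map (subtopology X {x \<in> topspace X. t x \<in> T i}) ?K (\<lambda>x. LeftEnd (p x))"
        using continuous_map_LeftEnd topspace_E_space_nonempty[OF G] by blast
      then show ?thesis
        by (rule continuous_map_eq) (auto simp: 1 T_def h_def u_def join_comb_def)
    next
      case 2
      have "continuous_map (subtopology X {x \<in> topspace X. t x \<in> T i}) (E_space G k) p"
        using p_cont by (rule continuous_map_from_subtopology_mono) (auto simp: 2 T_def)
      moreover have "continuous_map (subtopology X {x \<in> topspace X. t x \<in> T i}) (E_space G 0) r"
        using r_cont by (rule continuous_map_from_subtopology_mono) (auto simp: 2 T_def)
      ultimately show ?thesis
        unfolding h_def
        by (rule continuous_map_join_comb[OF continuous_map_from_subtopology[OF u_cont]])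
    next
      case 3
      have "continuous_map (subtopology X {x \<in> topspace X. t x \<in> T i}) (E_space G 0) r"
        using r_cont by (rule continuous_map_from_subtopology_mono) (auto simp: 3 T_def)
      then have "continuous_map (subtopology X {x \<in> topspace X. t x \<in> T i}) ?K (\<lambda>x. RightEnd (r x))"
        using continuous_map_RightEnd topspace_E_space_nonempty[OF G] by blast
      then show ?thesis
        by (rule continuous_map_eq) (auto simp: 3 T_def h_def u_def join_comb_def)
    qed
  next
    fix x assume x: "x \<in> topspace X"
    have "t x \<in> T 0 \<or> t x \<in> T 1 \<or> t x \<in> T 2"
      unfolding T_def by simp linarith
    with x show "\<exists>i. i \<in> {0, 1, 2} \<and> x \<in> {x \<in> topspace X. t x \<in> T i} \<and> h x = h x"
      by blast
  qed simp
  moreover have "h (\<phi> g x) = translate G g (h x)" if g: "g \<in> carrier G" and x: "x \<in> topspace X" for g x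
  proof -
    have t_eq: "t (\<phi> g x) = t x"
      by (simp add: t_def f_eq[OF g x])
    have r_eq: "r (\<phi> g x) = translate G g (r x)" if "0 < t x"
      using that join_right_translate[OF f_in[OF x]] by (simp add: r_def t_def f_eq[OF g x])
    \<comment> \<open>At each end one coordinate has no known equivariance, but there
      \<open>u\<close> is 0 or 1 and \<open>join_comb\<close> discards exactly that
      coordinate.\<close>
    consider "t x = 0" | "0 < t x" "t x < 1" | "t x = 1"
      using t_in[OF x] by fastforce
    then show ?thesis
      by cases (simp_all add: h_def t_eq r_eq p_eq[OF g x] u_def join_comb_def)
  qed
  ultimately show ?thesis
    unfolding equivariant_map_E_space_Suc_iff by blast
qed

text \<open>Of the action on \<open>X\<close> only stability of the underlying set is assumed: this
  passes to the part \<open>t < 1\<close> with the same \<open>\<phi>\<close>, whereas a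
  \<open>G_space\<close> would require restricting \<open>\<phi>\<close> anew, actions being
  extensional.\<close>

lemma equivariant_map_E_space_of_prod:
  assumes G: "group G" and "k < n"
    and "\<And>g x. g \<in> carrier G \<Longrightarrow> x \<in> topspace X \<Longrightarrow> \<phi> g x \<in> topspace X"
    and "equivariant_map G X \<phi> (E_space G m) (E_action G m) f"
    and "equivariant_map G (prod_topology X (E_space G n))
      (diagonal_action X \<phi> (E_space G n) (E_action G n)) (E_space G k) (E_action G k) F"
  shows "\<exists>h. equivariant_map G X \<phi> (E_space G k) (E_action G k) h"
  using assms(3-5)
proof (induction m arbitrary: X f)
  case 0
  then obtain e where "equivariant_map G X \<phi> (E_space G n) (E_action G n) e"
    using equivariant_map_E_space_mono[OF G] by blast
  then show ?case
    using equivariant_map_compose[OF equivariant_map_graph 0(3)] by blast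
next
  case (Suc m)
  let ?X0 = "subtopology X {x. join_param (f x) < 1}"
  have f_cont: "continuous_map X (join_topology (E_space G m) (E_space G 0)) f"
    and f_eq: "\<And>g x. g \<in> carrier G \<Longrightarrow> x \<in> topspace X \<Longrightarrow> f (\<phi> g x) = translate G g (f x)"
    using Suc.prems(2) by (simp_all only: equivariant_map_E_space_Suc_iff)
  \<comment> \<open>Translation does not change the join parameter.\<close>
  have inv: "\<phi> g x \<in> topspace ?X0" if "g \<in> carrier G" "x \<in> topspace ?X0" for g x
    using that Suc.prems(1) by (auto simp: f_eq)
  have "continuous_map ?X0
      (subtopology (join_topology (E_space G m) (E_space G 0)) {x. join_param x < 1}) f"
    using f_cont by (auto simp: continuous_map_in_subtopology continuous_map_from_subtopology)
  from continuous_map_compose[OF this continuous_map_join_left]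
  have "equivariant_map G ?X0 \<phi> (E_space G m) (E_action G m) (join_left \<circ> f)"
    using join_left_translate continuous_map_image_subset_topspace[OF f_cont]
    by (fastforce simp: equivariant_map_E_space_iff f_eq)
  then obtain p where "equivariant_map G ?X0 \<phi> (E_space G k) (E_action G k) p"
    using Suc.IH[OF inv _ equivariant_map_prod_from_subtopology[OF Suc.prems(3)]] by blast
  then have "\<exists>h. equivariant_map G X \<phi> (E_space G (Suc k)) (E_action G (Suc k)) h"
    using equivariant_map_E_space_Suc_extend[OF G Suc.prems(2)] by blast
  \<comment> \<open>Strictness of \<open>k < n\<close> enters here, as \<open>Suc k \<le> n\<close>;
    the map sought is then \<open>x\<close> to \<open>F (x, e x)\<close>.\<close>
  then obtain e where "equivariant_map G X \<phi> (E_space G n) (E_action G n) e"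
    using equivariant_map_E_space_mono[OF G] \<open>k < n\<close> by (meson Suc_leI)
  then show ?case
    using equivariant_map_compose[OF equivariant_map_graph Suc.prems(3)] by blast
qed

section \<open>The mapping index\<close>

lemma mapping_index_le:
  assumes "equivariant_map G X \<phi> (E_space G k) (E_action G k) f"
  shows "mapping_index G X \<phi> \<le> enat k"
  unfolding mapping_index_def using assms by (intro Inf_lower) blast

text \<open>The infimum is attained: being finite it is not that of the empty set, and a nonempty
  set of extended naturals has a least element.\<close>

lemma mapping_index_eq_enatD:
  assumes "mapping_index G X \<phi> = enat k"
  shows "\<exists>f. equivariant_map G X \<phi> (E_space G k) (E_action G k) f"
proof -
  let ?A = "{enat k | k. \<exists>f. equivariant_map G X \<phi> (E_space G k) (E_action G k) f}"
  have "?A \<noteq> {}"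
    using assms by (auto simp: mapping_index_def Inf_enat_def split: if_splits)
  then obtain a where "a \<in> ?A"
    by blast
  then have "(LEAST a. a \<in> ?A) \<in> ?A"
    by (rule LeastI)
  then have "Inf ?A \<in> ?A"
    using \<open>?A \<noteq> {}\<close> by (simp only: Inf_enat_def if_False)
  then show ?thesis
    using assms by (auto simp: mapping_index_def)
qed

lemma mapping_index_mono:
  assumes "equivariant_map G X \<phi> Y \<psi> f"
  shows "mapping_index G X \<phi> \<le> mapping_index G Y \<psi>"
proof (cases "mapping_index G Y \<psi>")
  case (enat k)
  then show ?thesis
    using mapping_index_eq_enatD equivariant_map_compose[OF assms] mapping_index_le by metis
qed simp

theorem theorem3p4:
  fixes G :: "('g, 'm) monoid_scheme"
    and X :: "'x topology"
    and \<phi> :: "'g \<Rightarrow> 'x \<Rightarrow> 'x"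
    and n :: nat
  assumes "group G"
    and "finite (carrier G)"
    and "G_space G X \<phi>"
    and "mapping_index G X \<phi> < \<infinity>"
  shows "mapping_index G (prod_topology X (E_space G n))
           (diagonal_action X \<phi> (E_space G n) (E_action G n)) =
         min (mapping_index G X \<phi>) (enat n)"
    (is "?i = _")
proof (rule antisym)
  interpret G_space G X \<phi> by (fact assms(3))
  have "mapping_index G (E_space G n) (E_action G n) \<le> enat n"
    by (rule mapping_index_le[where f = id]) (simp add: equivariant_map_def)
  \<comment> \<open>The two projections of the product give the two bounds.\<close>
  then show "?i \<le> min (mapping_index G X \<phi>) (enat n)"
    using mapping_index_mono[OF equivariant_map_fst] mapping_index_mono[OF equivariant_map_snd]
    by (meson min.boundedI order_trans)
  show "min (mapping_index G X \<phi>) (enat n) \<le> ?i"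
  proof (rule ccontr)
    assume "\<not> ?thesis"
    then have less: "?i < mapping_index G X \<phi>" "?i < enat n"
      by (simp_all add: min_le_iff_disj not_le)
    then obtain k where k: "?i = enat k" "k < n"
      by (cases ?i) auto
    \<comment> \<open>Finiteness of the index provides the \<open>m\<close> on which the induction
      runs; it may exceed \<open>n\<close>.\<close>
    obtain m where "mapping_index G X \<phi> = enat m"
      using assms(4) by auto
    then obtain f where "equivariant_map G X \<phi> (E_space G m) (E_action G m) f"
      using mapping_index_eq_enatD by blast
    moreover obtain F where "equivariant_map G (prod_topology X (E_space G n))
        (diagonal_action X \<phi> (E_space G n) (E_action G n)) (E_space G k) (E_action G k) F"
      using mapping_index_eq_enatD[OF k(1)] by blast
    moreover have "\<phi> g x \<in> topspace X" if "g \<in> carrier G" "x \<in> topspace X" for g x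
      using that element_image by blast
    ultimately have "mapping_index G X \<phi> \<le> enat k"
      using equivariant_map_E_space_of_prod[OF assms(1) k(2), of X \<phi> m f F] mapping_index_le
      by blast
    then show False
      using less k by simp
  qed
qed

end
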